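(* Let $\Gamma=(V,E)$ be a finite, undirected, weighted, connected graph with $N\ge 2$ vertices (loops allowed), and let $P$ be the transition probability operator of the random walk on $\Gamma$. For every function $f:V\to\mathbb{R}$, every positive integer $t$ and every even integer $l\ge2$, $$\|P^tf-\overline{f}\|\le(1-h^2[l])^{\frac{t}{2l}}\,\|f\|,$$ where $\overline{f}=\frac{1}{\mathrm{vol}(V)}\sum_jd_jf(j)$ (viewed as a constant function) and $h[l]$ is the Cheeger constant of the neighborhood graph $\Gamma[l]$.
   Context: The weight function $w:V\times V\to\mathbb{R}$ satisfies $w_{ij}=w_{ji}$, $w_{ij}>0$ if $i\sim j$ (i.e. $i,j$ are joined by an edge; $i=j$ allowed, a loop) and $w_{ij}=0$ otherwise. The degree is $d_i=\sum_{j}w_{ij}$, $\mathrm{vol}(V)=\sum_id_i$, $Pv(i)=\frac1{d_i}\sum_jw_{ij}v(j)$, and $\|f\|=\left(\sum_id_if(i)^2\right)^{1/2}$. The neighborhood graph $\Gamma[l]$ is the weighted graph on the same vertex set $V$ with weights, for $l>1$, $$w_{ij}[l]=\sum_{k_1,\dots,k_{l-1}\in V}\frac{1}{d_{k_1}}\cdots\frac{1}{d_{k_{l-1}}}w_{ik_1}w_{k_1k_2}\cdots w_{k_{l-1}j},$$ and degrees $d_i[l]=\sum_jw_{ij}[l]$ (which equal $d_i$). Its Cheeger constant is $$h[l]=\min_{U}\frac{\sum_{k\in U,\,m\in V\setminus U}w_{km}[l]}{\min\{\sum_{i\in U}d_i[l],\ \sum_{i\in V\setminus U}d_i[l]\}},$$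 the minimum over $U\subset V$ with $U$ and $V\setminus U$ nonempty; $0\le h[l]\le1$ and $h^2[l]=(h[l])^2$. *)

theory Defs
  imports "HOL-Analysis.Analysis"
begin

text \<open>An undirected edge joining \<open>i\<close> and \<open>j\<close> is represented by the two pairs
  \<open>(i, j)\<close> and \<open>(j, i)\<close>, a loop at \<open>i\<close> by \<open>(i, i)\<close>. Weights and functions on the
  vertices are total in HOL; only their values on the vertex set \<open>V\<close> are ever used.\<close>

locale weighted_graph =
  fixes V :: "'a set" and E :: "('a \<times> 'a) set" and w :: "'a \<Rightarrow> 'a \<Rightarrow> real"
  assumes finite_vertices: "finite V"
    and edges_subset: "E \<subseteq> V \<times> V"
    and edges_sym: "sym E"
    and weight_sym: "\<And>i j. i \<in> V \<Longrightarrow> j \<in> V \<Longrightarrow> w i j = w j i"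
    and weight_edge: "\<And>i j. (i, j) \<in> E \<Longrightarrow> w i j > 0"
    and weight_nonedge: "\<And>i j. i \<in> V \<Longrightarrow> j \<in> V \<Longrightarrow> (i, j) \<notin> E \<Longrightarrow> w i j = 0"

locale connected_weighted_graph = weighted_graph +
  assumes connected: "\<And>i j. i \<in> V \<Longrightarrow> j \<in> V \<Longrightarrow> (i, j) \<in> E\<^sup>*"

definition degree :: "'a set \<Rightarrow> ('a \<Rightarrow> 'a \<Rightarrow> real) \<Rightarrow> 'a \<Rightarrow> real" where
  "degree V w i = (\<Sum>j\<in>V. w i j)"

definition volume :: "'a set \<Rightarrow> ('a \<Rightarrow> 'a \<Rightarrow> real) \<Rightarrow> real" where
  "volume V w = (\<Sum>i\<in>V. degree V w i)"

definition transition_op :: "'a set \<Rightarrow> ('a \<Rightarrow> 'a \<Rightarrow> real) \<Rightarrow> ('a \<Rightarrow> real) \<Rightarrow> 'a \<Rightarrow> real" where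
  "transition_op V w v i = 1 / degree V w i * (\<Sum>j\<in>V. w i j * v j)"

definition weighted_norm :: "'a set \<Rightarrow> ('a \<Rightarrow> 'a \<Rightarrow> real) \<Rightarrow> ('a \<Rightarrow> real) \<Rightarrow> real" where
  "weighted_norm V w f = sqrt (\<Sum>i\<in>V. degree V w i * (f i)\<^sup>2)"

definition weighted_mean :: "'a set \<Rightarrow> ('a \<Rightarrow> 'a \<Rightarrow> real) \<Rightarrow> ('a \<Rightarrow> real) \<Rightarrow> real" where
  "weighted_mean V w f = 1 / volume V w * (\<Sum>j\<in>V. degree V w j * f j)"

text \<open>The list \<open>ks\<close> holds the intermediate vertices \<open>k\<^sub>1, \<dots>, k\<^bsub>l-1\<^esub>\<close>, so that
  \<open>i # ks @ [j]\<close> lists the \<open>l + 1\<close> vertices of a walk of \<open>l\<close> steps. The definition is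
  meant for \<open>l \<ge> 1\<close>; it gives back \<open>w\<close> for \<open>l = 1\<close>.\<close>

definition neighborhood_weight ::
    "'a set \<Rightarrow> ('a \<Rightarrow> 'a \<Rightarrow> real) \<Rightarrow> nat \<Rightarrow> 'a \<Rightarrow> 'a \<Rightarrow> real" where
  "neighborhood_weight V w l i j =
     (\<Sum>ks | set ks \<subseteq> V \<and> length ks = l - 1.
        (\<Prod>r<l - 1. 1 / degree V w (ks ! r)) *
        (\<Prod>r<l. w ((i # ks @ [j]) ! r) ((i # ks @ [j]) ! Suc r)))"

text \<open>The minimum ranges over a finite set of cuts, which is nonempty as soon as \<open>V\<close> is
  finite with at least two elements.\<close>

definition cheeger_constant :: "'a set \<Rightarrow> ('a \<Rightarrow> 'a \<Rightarrow> real) \<Rightarrow> real" where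
  "cheeger_constant V w =
     (MIN U\<in>{U. U \<subseteq> V \<and> U \<noteq> {} \<and> V - U \<noteq> {}}.
        (\<Sum>k\<in>U. \<Sum>m\<in>V - U. w k m) /
        min (\<Sum>i\<in>U. degree V w i) (\<Sum>i\<in>V - U. degree V w i))"

text \<open>\<open>h[l]\<close>; the degrees in the quotient are those of the neighborhood graph itself.\<close>

definition neighborhood_cheeger :: "'a set \<Rightarrow> ('a \<Rightarrow> 'a \<Rightarrow> real) \<Rightarrow> nat \<Rightarrow> real" where
  "neighborhood_cheeger V w l = cheeger_constant V (neighborhood_weight V w l)"

end

theory Submission
  imports Defs
begin

text \<open>For a function \<open>v\<close> of mean zero, Cheeger's inequality in \<open>\<Gamma>[l]\<close>, whose transition operator is \<open>P\<^sup>l\<close>,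
  gives \<open>\<langle>P\<^sup>l v, v\<rangle> \<le> sqrt (1 - h[l]\<^sup>2) \<parallel>v\<parallel>\<^sup>2\<close>; for \<open>l = 2 m\<close> the left side is \<open>\<parallel>P\<^sup>m v\<parallel>\<^sup>2\<close>. As \<open>P\<close> is
  self-adjoint, the sequence \<open>\<parallel>P\<^sup>n v\<parallel>\<^sup>2\<close> is log-convex, so the bound for \<open>m\<close> steps descends to a single
  step, \<open>\<parallel>P v\<parallel>\<^sup>2 \<le> (1 - h[l]\<^sup>2)\<^bsup>1/l\<^esup> \<parallel>v\<parallel>\<^sup>2\<close>. Iterating this on \<open>f\<close> minus its mean also covers the \<open>t\<close>
  that are not multiples of \<open>m\<close>.\<close>

section \<open>Weighted networks: inner product and transition operator\<close>

text \<open>This locale collects what passes to the neighborhood graph. Positive degrees stand in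
  for connectedness because \<open>\<Gamma>[l]\<close> can be disconnected, for instance for
  bipartite \<open>\<Gamma>\<close> and even \<open>l\<close>.\<close>

locale weighted_network =
  fixes V :: "'a set" and w :: "'a \<Rightarrow> 'a \<Rightarrow> real"
  assumes finite_V: "finite V"
    and w_sym: "\<And>i j. i \<in> V \<Longrightarrow> j \<in> V \<Longrightarrow> w i j = w j i"
    and w_nonneg: "\<And>i j. i \<in> V \<Longrightarrow> j \<in> V \<Longrightarrow> w i j \<ge> 0"
    and degree_pos: "\<And>i. i \<in> V \<Longrightarrow> degree V w i > 0"
begin

abbreviation "deg \<equiv> degree V w"
abbreviation "P \<equiv> transition_op V w"

definition inner_prod :: "('a \<Rightarrow> real) \<Rightarrow> ('a \<Rightarrow> real) \<Rightarrow> real" where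
  "inner_prod u v = (\<Sum>i\<in>V. deg i * (u i * v i))"

abbreviation sq_norm :: "('a \<Rightarrow> real) \<Rightarrow> real" where
  "sq_norm u \<equiv> inner_prod u u"

text \<open>Halving compensates for each unordered pair being summed twice, so that the form equals
  \<open>\<langle>u - P u, u\<rangle>\<close>.\<close>

definition dirichlet :: "('a \<Rightarrow> real) \<Rightarrow> real" where
  "dirichlet u = (\<Sum>i\<in>V. \<Sum>j\<in>V. w i j * (u i - u j)\<^sup>2) / 2"

lemma inner_prod_cong:
  "(\<And>i. i \<in> V \<Longrightarrow> u i = u' i) \<Longrightarrow> (\<And>i. i \<in> V \<Longrightarrow> v i = v' i) \<Longrightarrow> inner_prod u v = inner_prod u' v'"
  by (simp add: inner_prod_def)

lemma inner_prod_commute: "inner_prod u v = inner_prod v u"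
  by (simp add: inner_prod_def mult.commute)

lemma sq_norm_nonneg: "sq_norm u \<ge> 0"
  unfolding inner_prod_def using degree_pos by (intro sum_nonneg mult_nonneg_nonneg[OF _ zero_le_square]) (auto intro: less_imp_le)

lemma weighted_norm_eq: "weighted_norm V w u = sqrt (sq_norm u)"
  by (simp add: weighted_norm_def inner_prod_def power2_eq_square)

lemma inner_prod_Cauchy_Schwarz: "(inner_prod u v)\<^sup>2 \<le> sq_norm u * sq_norm v"
proof -
  have "inner_prod u v = (\<Sum>i\<in>V. (sqrt (deg i) * u i) * (sqrt (deg i) * v i))"
    unfolding inner_prod_def
    using degree_pos by (intro sum.cong refl) (simp add: less_imp_le algebra_simps)
  also have "\<dots>\<^sup>2 \<le> (\<Sum>i\<in>V. (sqrt (deg i) * u i)\<^sup>2) * (\<Sum>i\<in>V. (sqrt (deg i) * v i)\<^sup>2)"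
    by (rule Cauchy_Schwarz_ineq_sum)
  also have "\<dots> = sq_norm u * sq_norm v"
    unfolding inner_prod_def using degree_pos
    by (intro arg_cong2[where f = "(*)"] sum.cong refl)
       (simp_all add: power_mult_distrib less_imp_le power2_eq_square[of "u _"] power2_eq_square[of "v _"])
  finally show ?thesis .
qed

lemma deg_mult_transition_op: "i \<in> V \<Longrightarrow> deg i * P v i = (\<Sum>j\<in>V. w i j * v j)"
  using degree_pos[of i] by (simp add: transition_op_def)

lemma transition_op_cong: "(\<And>j. j \<in> V \<Longrightarrow> u j = v j) \<Longrightarrow> P u = P v"
  by (simp add: transition_op_def fun_eq_iff)

text \<open>The factor \<open>deg i\<close> cancels the denominator in \<open>P\<close>. What
  remains is a bilinear form with kernel \<open>w\<close>, so symmetry of \<open>w\<close> will make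
  \<open>P\<close> self-adjoint.\<close>

lemma inner_prod_transition_op:
  "inner_prod u (P v) = (\<Sum>i\<in>V. \<Sum>j\<in>V. w i j * (u i * v j))"
proof -
  have "inner_prod u (P v) = (\<Sum>i\<in>V. u i * (deg i * P v i))"
    by (simp add: inner_prod_def mult.left_commute)
  then show ?thesis
    by (simp add: deg_mult_transition_op sum_distrib_left mult.left_commute cong: sum.cong)
qed

lemma transition_op_self_adjoint: "inner_prod u (P v) = inner_prod (P u) v"
proof -
  have "inner_prod u (P v) = (\<Sum>j\<in>V. \<Sum>i\<in>V. w i j * (u i * v j))"
    unfolding inner_prod_transition_op by (rule sum.swap)
  also have "\<dots> = inner_prod v (P u)"
    unfolding inner_prod_transition_op
    by (intro sum.cong refl) (simp add: w_sym mult.commute[of "v _"])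
  finally show ?thesis by (simp add: inner_prod_commute)
qed

lemma transition_op_power_self_adjoint:
  "inner_prod u ((P ^^ n) v) = inner_prod ((P ^^ n) u) v"
proof (induction n arbitrary: u)
  case (Suc n)
  have "inner_prod u ((P ^^ Suc n) v) = inner_prod ((P ^^ n) (P u)) v"
    using Suc[of "P u"] by (simp add: transition_op_self_adjoint)
  then show ?case by (simp add: funpow_swap1)
qed simp

lemma transition_op_const: "i \<in> V \<Longrightarrow> P (\<lambda>_. c) i = c"
  using degree_pos[of i] by (simp add: transition_op_def degree_def flip: sum_distrib_right)

lemma transition_op_power_const: "i \<in> V \<Longrightarrow> (P ^^ n) (\<lambda>_. c) i = c"
proof (induction n arbitrary: i)
  case (Suc n)
  have "P ((P ^^ n) (\<lambda>_. c)) = P (\<lambda>_. c)"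
    by (rule transition_op_cong) (rule Suc.IH)
  then show ?case using Suc.prems by (simp add: transition_op_const)
qed simp

lemma transition_op_power_diff_const:
  "i \<in> V \<Longrightarrow> (P ^^ n) (\<lambda>j. u j - c) i = (P ^^ n) u i - c"
proof (induction n arbitrary: i)
  case (Suc n)
  have "P ((P ^^ n) (\<lambda>j. u j - c)) i = P (\<lambda>j. (P ^^ n) u j - c) i"
    by (rule fun_cong[OF transition_op_cong]) (rule Suc.IH)
  also have "\<dots> = P ((P ^^ n) u) i - P (\<lambda>_. c) i"
    by (simp add: transition_op_def right_diff_distrib sum_subtractf)
  finally show ?case using Suc.prems by (simp add: transition_op_const)
qed simp

section \<open>The Dirichlet form\<close>

lemma sum_sum_weight_left:
  "(\<Sum>i\<in>V. \<Sum>j\<in>V. w i j * g i) = (\<Sum>i\<in>V. deg i * g i)"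
  by (simp add: degree_def sum_distrib_right)

lemma sum_sum_weight_right:
  "(\<Sum>i\<in>V. \<Sum>j\<in>V. w i j * g j) = (\<Sum>i\<in>V. deg i * g i)"
proof -
  have "(\<Sum>i\<in>V. \<Sum>j\<in>V. w i j * g j) = (\<Sum>j\<in>V. \<Sum>i\<in>V. w i j * g j)"
    by (rule sum.swap)
  also have "\<dots> = (\<Sum>j\<in>V. \<Sum>i\<in>V. w j i * g j)"
    by (intro sum.cong refl) (simp add: w_sym)
  finally show ?thesis by (simp add: sum_sum_weight_left)
qed

lemma dirichlet_eq: "dirichlet u = sq_norm u - inner_prod u (P u)"
proof -
  have "(\<Sum>i\<in>V. \<Sum>j\<in>V. w i j * (u i - u j)\<^sup>2)
      = (\<Sum>i\<in>V. \<Sum>j\<in>V. w i j * (u i * u i)) + (\<Sum>i\<in>V. \<Sum>j\<in>V. w i j * (u j * u j))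
        - 2 * (\<Sum>i\<in>V. \<Sum>j\<in>V. w i j * (u i * u j))"
    unfolding sum_distrib_left sum.distrib[symmetric] sum_subtractf[symmetric]
    by (intro sum.cong refl) (simp add: power2_eq_square algebra_simps)
  then show ?thesis
    unfolding dirichlet_def inner_prod_transition_op
    using sum_sum_weight_left[of "\<lambda>i. u i * u i"] sum_sum_weight_right[of "\<lambda>i. u i * u i"]
    by (simp add: inner_prod_def)
qed

text \<open>Parallelogram identity, summed over all pairs. The left side is one of the two
  Cauchy-Schwarz factors in Cheeger's inequality.\<close>

lemma dirichlet_sum_eq:
  "(\<Sum>i\<in>V. \<Sum>j\<in>V. w i j * (u i + u j)\<^sup>2) / 2 = 2 * sq_norm u - dirichlet u"
proof -
  have "(\<Sum>i\<in>V. \<Sum>j\<in>V. w i j * (u i + u j)\<^sup>2)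
      = 2 * (\<Sum>i\<in>V. \<Sum>j\<in>V. w i j * (u i * u i)) + 2 * (\<Sum>i\<in>V. \<Sum>j\<in>V. w i j * (u j * u j))
        - (\<Sum>i\<in>V. \<Sum>j\<in>V. w i j * (u i - u j)\<^sup>2)"
    unfolding sum_distrib_left sum.distrib[symmetric] sum_subtractf[symmetric]
    by (intro sum.cong refl) (simp add: power2_eq_square algebra_simps)
  then show ?thesis
    unfolding dirichlet_def
    using sum_sum_weight_left[of "\<lambda>i. u i * u i"] sum_sum_weight_right[of "\<lambda>i. u i * u i"]
    by (simp add: inner_prod_def)
qed

lemma dirichlet_diff_const: "dirichlet (\<lambda>i. u i - c) = dirichlet u"
  by (simp add: dirichlet_def)

text \<open>Where \<open>u i\<close> and \<open>u j\<close> have the same sign, one part carries the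
  whole square. For opposite signs the cross term \<open>- 2 * u i * u j\<close> is nonnegative and
  is dropped.\<close>

lemma dirichlet_pos_neg_parts:
  "dirichlet (\<lambda>i. max (u i) 0) + dirichlet (\<lambda>i. max (- u i) 0) \<le> dirichlet u"
proof -
  have *: "(max a 0 - max b 0)\<^sup>2 + (max (- a) 0 - max (- b) 0)\<^sup>2 \<le> (a - b)\<^sup>2" for a b :: real
    by (cases "a \<ge> 0"; cases "b \<ge> 0")
       (auto simp: max_def power2_eq_square algebra_simps mult_nonneg_nonpos mult_nonpos_nonneg)
  have "(\<Sum>i\<in>V. \<Sum>j\<in>V. w i j * (max (u i) 0 - max (u j) 0)\<^sup>2)
      + (\<Sum>i\<in>V. \<Sum>j\<in>V. w i j * (max (- u i) 0 - max (- u j) 0)\<^sup>2)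
      \<le> (\<Sum>i\<in>V. \<Sum>j\<in>V. w i j * (u i - u j)\<^sup>2)"
    unfolding sum.distrib[symmetric] distrib_left[symmetric]
    by (intro sum_mono mult_left_mono * w_nonneg)
  then show ?thesis by (simp add: dirichlet_def)
qed

lemma sq_norm_pos_neg_parts:
  "sq_norm (\<lambda>i. max (u i) 0) + sq_norm (\<lambda>i. max (- u i) 0) = sq_norm u"
  unfolding inner_prod_def sum.distrib[symmetric] distrib_left[symmetric]
  by (intro sum.cong refl) (auto simp: max_def)

text \<open>Mean zero is orthogonality to constants, so the cross term vanishes and the shift only
  adds the squared norm of \<open>c\<close>.\<close>

lemma sq_norm_le_diff_const:
  assumes "(\<Sum>i\<in>V. deg i * u i) = 0"
  shows "sq_norm u \<le> sq_norm (\<lambda>i. u i - c)"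
proof -
  have "sq_norm (\<lambda>i. u i - c) = sq_norm u - 2 * c * (\<Sum>i\<in>V. deg i * u i) + (\<Sum>i\<in>V. deg i * c\<^sup>2)"
    unfolding inner_prod_def sum_distrib_left sum.distrib[symmetric] sum_subtractf[symmetric]
    by (intro sum.cong refl) (simp add: power2_eq_square algebra_simps)
  moreover have "(\<Sum>i\<in>V. deg i * c\<^sup>2) \<ge> 0"
    using degree_pos by (intro sum_nonneg mult_nonneg_nonneg) (auto intro: less_imp_le)
  ultimately show ?thesis using assms by simp
qed

section \<open>Cuts, the Cheeger constant and the co-area inequality\<close>

lemma cut_le_volume:
  assumes "U \<subseteq> V"
  shows "(\<Sum>k\<in>U. \<Sum>m\<in>V - U. w k m) \<le> sum deg U"
  unfolding degree_def using assms finite_V w_nonneg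
  by (intro sum_mono sum_mono2) auto

lemma cut_commute:
  assumes "U \<subseteq> V"
  shows "(\<Sum>k\<in>U. \<Sum>m\<in>V - U. w k m) = (\<Sum>k\<in>V - U. \<Sum>m\<in>U. w k m)"
proof -
  have "(\<Sum>k\<in>U. \<Sum>m\<in>V - U. w k m) = (\<Sum>m\<in>V - U. \<Sum>k\<in>U. w k m)"
    by (rule sum.swap)
  also have "\<dots> = (\<Sum>m\<in>V - U. \<Sum>k\<in>U. w m k)"
    using assms by (intro sum.cong refl w_sym) auto
  finally show ?thesis .
qed

lemma sum_deg_pos:
  assumes "U \<subseteq> V" "U \<noteq> {}"
  shows "sum deg U > 0"
  using assms finite_V degree_pos by (intro sum_pos) (auto intro: finite_subset)

lemma cheeger_bound:
  assumes "U \<subseteq> V" "U \<noteq> {}" "sum deg U \<le> sum deg (V - U)"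
  shows "cheeger_constant V w * sum deg U \<le> (\<Sum>k\<in>U. \<Sum>m\<in>V - U. w k m)"
proof -
  have pos: "sum deg U > 0" using assms by (intro sum_deg_pos)
  \<comment> \<open>An empty complement would have volume 0, below the positive volume of
    \<open>U\<close>.\<close>
  then have "V - U \<noteq> {}" using assms(3) by (metis less_le_not_le sum.empty)
  moreover have "finite {U. U \<subseteq> V \<and> U \<noteq> {} \<and> V - U \<noteq> {}}"
    by (rule finite_subset[of _ "Pow V"]) (use finite_V in auto)
  ultimately have "cheeger_constant V w
      \<le> (\<Sum>k\<in>U. \<Sum>m\<in>V - U. w k m) / min (sum deg U) (sum deg (V - U))"
    unfolding cheeger_constant_def using assms by (intro Min_le finite_imageI imageI) auto
  then show ?thesis using pos assms(3) by (simp add: pos_le_divide_eq)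
qed

text \<open>A cut weighs at most the volume of either of its sides, so every Cheeger quotient lies
  between 0 and 1, and the minimum is one of these quotients.\<close>

lemma cheeger_constant_range:
  assumes "card V \<ge> 2"
  shows "0 \<le> cheeger_constant V w" "cheeger_constant V w \<le> 1"
proof -
  let ?C = "{U. U \<subseteq> V \<and> U \<noteq> {} \<and> V - U \<noteq> {}}"
  let ?q = "\<lambda>U. (\<Sum>k\<in>U. \<Sum>m\<in>V - U. w k m) / min (sum deg U) (sum deg (V - U))"
  have q: "0 \<le> ?q U \<and> ?q U \<le> 1" if "U \<in> ?C" for U
  proof -
    have "sum deg U > 0" "sum deg (V - U) > 0" using that by (auto intro!: sum_deg_pos)
    moreover have "(\<Sum>k\<in>U. \<Sum>m\<in>V - U. w k m) \<le> sum deg (V - U)"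
      using cut_le_volume[of "V - U"] cut_commute[of U] that by (simp add: double_diff)
    moreover have "(\<Sum>k\<in>U. \<Sum>m\<in>V - U. w k m) \<le> sum deg U"
      using cut_le_volume[of U] that by simp
    moreover have "(\<Sum>k\<in>U. \<Sum>m\<in>V - U. w k m) \<ge> 0"
      using that w_nonneg by (intro sum_nonneg) auto
    ultimately show ?thesis by (simp add: divide_le_eq)
  qed
  have fin: "finite ?C" by (rule finite_subset[of _ "Pow V"]) (use finite_V in auto)
  \<comment> \<open>With two vertices a singleton is an admissible cut, so \<open>Min\<close> is
    taken over a nonempty set and is attained.\<close>
  obtain a where a: "a \<in> V" using assms by fastforce
  have "card (V - {a}) \<noteq> 0" using assms a by simp
  then have "V - {a} \<noteq> {}" by (metis card.empty)
  then have "{a} \<in> ?C" using a by simp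
  then have "?C \<noteq> {}" by blast
  then have "Min (?q ` ?C) \<in> ?q ` ?C" using fin by (intro Min_in finite_imageI) simp_all
  then obtain U where U: "U \<in> ?C" and "Min (?q ` ?C) = ?q U" by (rule imageE)
  then have eq: "cheeger_constant V w = ?q U" by (simp only: cheeger_constant_def)
  show "0 \<le> cheeger_constant V w" "cheeger_constant V w \<le> 1"
    unfolding eq using q[OF U] by blast+
qed

text \<open>A discrete co-area argument: subtracting the smallest positive value of \<open>q\<close> from \<open>q\<close> on its
  support \<open>U\<close> changes both sides by that value times the cut, respectively the volume, of \<open>U\<close>.\<close>

lemma cheeger_coarea:
  assumes "\<And>i. i \<in> V \<Longrightarrow> q i \<ge> 0" "sum deg {i \<in> V. q i > 0} \<le> sum deg V / 2"
  shows "cheeger_constant V w * (\<Sum>i\<in>V. deg i * q i) \<le> (\<Sum>i\<in>V. \<Sum>j\<in>V. w i j * max 0 (q i - q j))"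
  using assms
proof (induction "card {i \<in> V. q i > 0}" arbitrary: q rule: less_induct)
  case less
  define U where "U = {i \<in> V. q i > 0}"
  have U: "U \<subseteq> V" "finite U" using finite_V by (auto simp: U_def)
  show ?case
  proof (cases "U = {}")
    case True
    then have "\<forall>i\<in>V. q i = 0" using less.prems(1) by (auto simp: U_def order.antisym)
    then show ?thesis by simp
  next
    case False
    define \<delta> where "\<delta> = Min (q ` U)"
    have "\<delta> \<in> q ` U" unfolding \<delta>_def using False U by (intro Min_in) auto
    then obtain a where a: "a \<in> U" "q a = \<delta>" by auto
    have \<delta>: "\<delta> > 0" using a by (auto simp: U_def)
    have \<delta>_le: "\<delta> \<le> q i" if "i \<in> U" for i unfolding \<delta>_def using U that by simp
    define q' where "q' i = (if i \<in> U then q i - \<delta> else q i)" for i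
    have q'_nonneg: "q' i \<ge> 0" if "i \<in> V" for i
      using \<delta>_le less.prems(1) that by (simp add: q'_def)
    \<comment> \<open>The minimiser \<open>a\<close> leaves the support, so the induction measure
      drops strictly.\<close>
    have sub: "{i \<in> V. q' i > 0} \<subseteq> U - {a}"
      using \<delta> a by (auto simp: q'_def U_def split: if_splits)
    have "card {i \<in> V. q' i > 0} < card U"
      using sub a U by (intro psubset_card_mono) auto
    moreover have "sum deg {i \<in> V. q' i > 0} \<le> sum deg U"
      using sub U degree_pos by (intro sum_mono2) (auto intro: less_imp_le)
    ultimately have IH: "cheeger_constant V w * (\<Sum>i\<in>V. deg i * q' i)
        \<le> (\<Sum>i\<in>V. \<Sum>j\<in>V. w i j * max 0 (q' i - q' j))"
      using less.hyps[of q'] q'_nonneg less.prems(2) by (fold U_def) auto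
    \<comment> \<open>The half-volume hypothesis makes \<open>U\<close> the smaller side, as
      \<open>cheeger_bound\<close> requires.\<close>
    have "sum deg V = sum deg U + sum deg (V - U)"
      using U finite_V by (metis add.commute sum.subset_diff)
    then have bound: "cheeger_constant V w * sum deg U \<le> (\<Sum>i\<in>U. \<Sum>j\<in>V - U. w i j)"
      using less.prems(2) U False by (intro cheeger_bound) (auto simp: U_def)
    have "(\<Sum>i\<in>V. deg i * q i) = (\<Sum>i\<in>V. deg i * q' i + (if i \<in> U then \<delta> * deg i else 0))"
      by (intro sum.cong) (auto simp: q'_def algebra_simps)
    also have "\<dots> = (\<Sum>i\<in>V. deg i * q' i) + \<delta> * sum deg U"
      using U finite_V by (simp add: sum.distrib sum_distrib_left flip: sum.inter_restrict)
         (simp add: Int_absorb1)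
    finally have lhs: "(\<Sum>i\<in>V. deg i * q i) = (\<Sum>i\<in>V. deg i * q' i) + \<delta> * sum deg U" .
    \<comment> \<open>Inside \<open>U\<close> differences are unchanged, and outside
      \<open>U\<close> the function \<open>q\<close> is 0. From outside into \<open>U\<close> both
      maxima are 0, so only pairs leaving \<open>U\<close> gain \<open>\<delta>\<close>.\<close>
    have "w i j * max 0 (q i - q j)
        = w i j * max 0 (q' i - q' j) + (if i \<in> U then if j \<in> V - U then \<delta> * w i j else 0 else 0)"
      if "i \<in> V" "j \<in> V" for i j
    proof -
      have "q k = 0" if "k \<in> V" "k \<notin> U" for k
        using that less.prems(1) by (auto simp: U_def order.antisym)
      then show ?thesis using that \<delta> \<delta>_le[of i] \<delta>_le[of j] less.prems(1)
        by (auto simp: q'_def max_def algebra_simps)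
    qed
    then have "(\<Sum>i\<in>V. \<Sum>j\<in>V. w i j * max 0 (q i - q j))
        = (\<Sum>i\<in>V. (\<Sum>j\<in>V. w i j * max 0 (q' i - q' j))
            + (if i \<in> U then (\<Sum>j\<in>V. if j \<in> V - U then \<delta> * w i j else 0) else 0))"
      by (intro sum.cong) (auto simp: sum.distrib simp del: Diff_iff)
    also have "\<dots> = (\<Sum>i\<in>V. \<Sum>j\<in>V. w i j * max 0 (q' i - q' j)) + \<delta> * (\<Sum>i\<in>U. \<Sum>j\<in>V - U. w i j)"
    proof -
      have "(\<Sum>j\<in>V. if j \<in> V - U then \<delta> * w i j else 0) = \<delta> * (\<Sum>j\<in>V - U. w i j)" for i
        using finite_V by (subst sum.inter_restrict[symmetric]) (auto simp: sum_distrib_left Int_absorb1)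
      moreover have "V \<inter> U = U" using U by auto
      ultimately show ?thesis using finite_V
        by (simp add: sum.distrib sum_distrib_left[of \<delta> _ U] flip: sum.inter_restrict)
    qed
    finally have "(\<Sum>i\<in>V. \<Sum>j\<in>V. w i j * max 0 (q i - q j))
        = (\<Sum>i\<in>V. \<Sum>j\<in>V. w i j * max 0 (q' i - q' j)) + \<delta> * (\<Sum>i\<in>U. \<Sum>j\<in>V - U. w i j)" .
    moreover have "\<delta> * (cheeger_constant V w * sum deg U) \<le> \<delta> * (\<Sum>i\<in>U. \<Sum>j\<in>V - U. w i j)"
      using bound \<delta> by simp
    ultimately show ?thesis using IH lhs by (simp add: algebra_simps)
  qed
qed

section \<open>Cheeger's inequality\<close>

lemma sum_sum_max_eq_abs:
  "(\<Sum>i\<in>V. \<Sum>j\<in>V. w i j * max 0 (q i - q j)) = (\<Sum>i\<in>V. \<Sum>j\<in>V. w i j * \<bar>q i - q j\<bar>) / 2"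
proof -
  have "(\<Sum>i\<in>V. \<Sum>j\<in>V. w i j * max 0 (q i - q j)) = (\<Sum>j\<in>V. \<Sum>i\<in>V. w i j * max 0 (q i - q j))"
    by (rule sum.swap)
  also have "\<dots> = (\<Sum>i\<in>V. \<Sum>j\<in>V. w i j * max 0 (q j - q i))"
    by (intro sum.cong refl) (simp add: w_sym)
  finally have "2 * (\<Sum>i\<in>V. \<Sum>j\<in>V. w i j * max 0 (q i - q j))
      = (\<Sum>i\<in>V. \<Sum>j\<in>V. w i j * max 0 (q i - q j)) + (\<Sum>i\<in>V. \<Sum>j\<in>V. w i j * max 0 (q j - q i))"
    by simp
  also have "\<dots> = (\<Sum>i\<in>V. \<Sum>j\<in>V. w i j * \<bar>q i - q j\<bar>)"
    unfolding sum.distrib[symmetric] distrib_left[symmetric]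
    by (intro sum.cong refl) (auto simp: max_def)
  finally show ?thesis by simp
qed

text \<open>The ordinary inequality over \<open>V \<times> V\<close>, with the root of the weight
  absorbed into each factor.\<close>

lemma sum_sum_Cauchy_Schwarz:
  "(\<Sum>i\<in>V. \<Sum>j\<in>V. w i j * (a i j * b i j))\<^sup>2
    \<le> (\<Sum>i\<in>V. \<Sum>j\<in>V. w i j * (a i j)\<^sup>2) * (\<Sum>i\<in>V. \<Sum>j\<in>V. w i j * (b i j)\<^sup>2)"
proof -
  let ?s = "\<lambda>p. sqrt (w (fst p) (snd p))"
  have s: "?s p * ?s p = w (fst p) (snd p)" if "p \<in> V \<times> V" for p
    using that w_nonneg by auto
  have "(\<Sum>p\<in>V \<times> V. (?s p * a (fst p) (snd p)) * (?s p * b (fst p) (snd p)))\<^sup>2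
      \<le> (\<Sum>p\<in>V \<times> V. (?s p * a (fst p) (snd p))\<^sup>2) * (\<Sum>p\<in>V \<times> V. (?s p * b (fst p) (snd p))\<^sup>2)"
    by (rule Cauchy_Schwarz_ineq_sum)
  moreover have "(\<Sum>p\<in>V \<times> V. (?s p * c (fst p) (snd p)) * (?s p * e (fst p) (snd p)))
      = (\<Sum>i\<in>V. \<Sum>j\<in>V. w i j * (c i j * e i j))" for c e
    unfolding sum.cartesian_product case_prod_unfold
  proof (intro sum.cong refl)
    fix p assume "p \<in> V \<times> V"
    have "(?s p * c (fst p) (snd p)) * (?s p * e (fst p) (snd p))
        = (?s p * ?s p) * (c (fst p) (snd p) * e (fst p) (snd p))"
      by (simp only: mult_ac)
    then show "(?s p * c (fst p) (snd p)) * (?s p * e (fst p) (snd p))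
        = w (fst p) (snd p) * (c (fst p) (snd p) * e (fst p) (snd p))"
      unfolding s[OF \<open>p \<in> V \<times> V\<close>] .
  qed
  ultimately show ?thesis by (simp add: power2_eq_square)
qed

text \<open>The co-area inequality is applied to the square of \<open>g\<close>, whose differences
  factor as \<open>(g i - g j) * (g i + g j)\<close>. With \<open>S = sq_norm g\<close> and
  \<open>D = dirichlet g\<close>, Cauchy-Schwarz gives
  \<open>(h S)^2 \<le> D (2 S - D)\<close>.\<close>

lemma cheeger_dirichlet_half_volume:
  assumes card: "card V \<ge> 2" and g: "\<And>i. i \<in> V \<Longrightarrow> g i \<ge> 0"
    and half: "sum deg {i \<in> V. g i > 0} \<le> sum deg V / 2"
  shows "(1 - sqrt (1 - (cheeger_constant V w)\<^sup>2)) * sq_norm g \<le> dirichlet g"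
proof -
  define h where "h = cheeger_constant V w"
  define c where "c = sqrt (1 - h\<^sup>2)"
  have h: "0 \<le> h" "h \<le> 1" using cheeger_constant_range[OF card] by (auto simp: h_def)
  then have c: "c \<ge> 0" "c\<^sup>2 = 1 - h\<^sup>2" by (auto simp: c_def abs_square_le_1)
  have "{i \<in> V. (g i)\<^sup>2 > 0} = {i \<in> V. g i > 0}"
    using g by (auto simp: less_le)
  then have "h * sq_norm g \<le> (\<Sum>i\<in>V. \<Sum>j\<in>V. w i j * \<bar>(g i)\<^sup>2 - (g j)\<^sup>2\<bar>) / 2"
    using cheeger_coarea[of "\<lambda>i. (g i)\<^sup>2"] half
    by (simp add: sum_sum_max_eq_abs inner_prod_def h_def power2_eq_square[of "g _"])
  also have "\<dots> = (\<Sum>i\<in>V. \<Sum>j\<in>V. w i j * (\<bar>g i - g j\<bar> * (g i + g j))) / 2"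
  proof -
    have "\<bar>(g i)\<^sup>2 - (g j)\<^sup>2\<bar> = \<bar>g i - g j\<bar> * (g i + g j)" if "i \<in> V" "j \<in> V" for i j
      using g[OF that(1)] g[OF that(2)]
      by (simp add: power2_eq_square square_diff_square_factored abs_mult mult.commute)
    then show ?thesis by simp
  qed
  finally have "(h * sq_norm g)\<^sup>2 \<le> ((\<Sum>i\<in>V. \<Sum>j\<in>V. w i j * (\<bar>g i - g j\<bar> * (g i + g j))) / 2)\<^sup>2"
    using h sq_norm_nonneg by (intro power_mono) auto
  also have "\<dots> \<le> dirichlet g * (2 * sq_norm g - dirichlet g)"
    using sum_sum_Cauchy_Schwarz[of "\<lambda>i j. \<bar>g i - g j\<bar>" "\<lambda>i j. g i + g j"]
    unfolding dirichlet_sum_eq[symmetric] by (simp add: dirichlet_def power_divide)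
  \<comment> \<open>Completing the square: \<open>D (2 S - D) = S^2 - (S - D)^2\<close>. Keeping
    this exact form yields the constant \<open>1 - sqrt (1 - h^2)\<close>.\<close>
  finally have main: "(sq_norm g - dirichlet g)\<^sup>2 \<le> (c * sq_norm g)\<^sup>2"
    by (simp add: power_mult_distrib c(2)) (simp add: power2_eq_square algebra_simps)
  then have "sq_norm g - dirichlet g \<le> c * sq_norm g"
    by (rule power2_le_imp_le) (simp add: c sq_norm_nonneg)
  then show ?thesis by (simp add: c_def h_def algebra_simps)
qed

text \<open>The median is the smallest value of \<open>v\<close> with at most half of the volume
  strictly above it.\<close>

lemma weighted_median_exists:
  fixes v :: "'a \<Rightarrow> real"
  assumes "V \<noteq> {}"
  obtains m where "sum deg {i \<in> V. v i > m} \<le> sum deg V / 2" "sum deg {i \<in> V. v i < m} \<le> sum deg V / 2"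
proof -
  define S where "S = {x \<in> v ` V. sum deg {i \<in> V. v i > x} \<le> sum deg V / 2}"
  have vol: "sum deg V > 0" using assms by (intro sum_deg_pos) auto
  have fin: "finite (v ` V)" "finite S" using finite_V by (auto simp: S_def)
  have "{i \<in> V. v i > Max (v ` V)} = {}" using fin by (auto simp: not_less)
  then have "sum deg {i \<in> V. v i > Max (v ` V)} = 0" by (simp only: sum.empty)
  then have "Max (v ` V) \<in> S" using fin assms vol unfolding S_def by simp
  then have "Min S \<in> S" using fin by (intro Min_in) auto
  define m where "m = Min S"
  have m: "sum deg {i \<in> V. v i > m} \<le> sum deg V / 2"
    using \<open>Min S \<in> S\<close> by (auto simp: S_def m_def)
  moreover have "sum deg {i \<in> V. v i < m} \<le> sum deg V / 2"
  proof (rule ccontr)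
    assume big: "\<not> sum deg {i \<in> V. v i < m} \<le> sum deg V / 2"
    define B where "B = {i \<in> V. v i < m}"
    have "sum deg B > 0" using big vol by (simp add: B_def)
    then have "B \<noteq> {}" by auto
    moreover have "finite B" "B \<subseteq> V" using finite_V by (auto simp: B_def)
    ultimately have B: "B \<noteq> {}" "finite B" "B \<subseteq> V" by auto
    \<comment> \<open>The largest value below \<open>m\<close>: all vertices above \<open>x\<close>
      lie outside \<open>B\<close>, hence carry less than half of the volume. So \<open>x\<close> is
      in \<open>S\<close>, against minimality of \<open>m\<close>.\<close>
    define x where "x = Max (v ` B)"
    have x: "x \<in> v ` B" unfolding x_def using B by (intro Max_in) auto
    have "{i \<in> V. v i > x} \<subseteq> V - B"
      using B by (auto simp: x_def)
    then have "sum deg {i \<in> V. v i > x} \<le> sum deg (V - B)"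
      using finite_V degree_pos by (intro sum_mono2) (auto intro: less_imp_le)
    also have "\<dots> = sum deg V - sum deg B" using B finite_V by (simp add: sum_diff)
    also have "\<dots> \<le> sum deg V / 2" using big by (simp add: B_def)
    finally have "x \<in> S" using x B by (auto simp: S_def)
    then have "m \<le> x" unfolding m_def using fin by simp
    moreover have "x < m" using x by (auto simp: B_def)
    ultimately show False by simp
  qed
  ultimately show thesis by (rule that)
qed

text \<open>Shifting \<open>v\<close> by a median makes both of its signed parts live on at most half of the volume. The shift
  does not change the Dirichlet form and can only increase the norm, so no eigenfunction is needed.\<close>

theorem cheeger_inequality:
  assumes card: "card V \<ge> 2" and mean: "(\<Sum>i\<in>V. deg i * v i) = 0"
  shows "inner_prod v (P v) \<le> sqrt (1 - (cheeger_constant V w)\<^sup>2) * sq_norm v"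
proof -
  define h where "h = cheeger_constant V w"
  have "0 \<le> h" "h \<le> 1" using cheeger_constant_range[OF card] by (auto simp: h_def)
  then have c: "1 - sqrt (1 - h\<^sup>2) \<ge> 0" by simp
  have "V \<noteq> {}" using card by auto
  then obtain m where m: "sum deg {i \<in> V. v i > m} \<le> sum deg V / 2"
      "sum deg {i \<in> V. v i < m} \<le> sum deg V / 2"
    by (rule weighted_median_exists)
  define u where "u i = v i - m" for i
  have "(1 - sqrt (1 - h\<^sup>2)) * sq_norm (\<lambda>i. max (u i) 0) \<le> dirichlet (\<lambda>i. max (u i) 0)"
    unfolding h_def using m(1) by (intro cheeger_dirichlet_half_volume card) (auto simp: u_def less_max_iff_disj)
  moreover have "(1 - sqrt (1 - h\<^sup>2)) * sq_norm (\<lambda>i. max (- u i) 0) \<le> dirichlet (\<lambda>i. max (- u i) 0)"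
    unfolding h_def using m(2) by (intro cheeger_dirichlet_half_volume card) (auto simp: u_def less_max_iff_disj)
  ultimately have "(1 - sqrt (1 - h\<^sup>2)) * sq_norm u \<le> dirichlet u"
    using dirichlet_pos_neg_parts[of u] unfolding sq_norm_pos_neg_parts[of u, symmetric]
    by (simp only: distrib_left)
  moreover have "(1 - sqrt (1 - h\<^sup>2)) * sq_norm v \<le> (1 - sqrt (1 - h\<^sup>2)) * sq_norm u"
    using sq_norm_le_diff_const[OF mean, of m] c by (intro mult_left_mono) (auto simp: u_def[abs_def])
  moreover have "dirichlet u = dirichlet v" by (simp add: u_def[abs_def] dirichlet_diff_const)
  ultimately show ?thesis unfolding dirichlet_eq[of v] h_def[symmetric] by (simp add: algebra_simps)
qed

section \<open>The neighborhood graph and the powers of the transition operator\<close>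

lemma neighborhood_weight_1: "neighborhood_weight V w 1 i j = w i j"
proof -
  have "{ks. set ks \<subseteq> V \<and> length ks = 0} = {[]}" by auto
  then show ?thesis by (simp add: neighborhood_weight_def)
qed

text \<open>The first intermediate vertex of the walk is split off. In matrix form, with
  \<open>D\<close> the diagonal of degrees, this reads
  \<open>W[l + 1] = W D^-1 W[l]\<close>.\<close>

lemma neighborhood_weight_Suc:
  assumes "l \<ge> 1"
  shows "neighborhood_weight V w (Suc l) i j = (\<Sum>k\<in>V. w i k / deg k * neighborhood_weight V w l k j)"
proof -
  \<comment> \<open>This removes the truncated subtraction \<open>l - 1\<close>: a walk of
    \<open>Suc l\<close> steps has \<open>Suc n\<close> intermediate vertices, one of
    \<open>l\<close> steps has \<open>n\<close>.\<close>
  obtain n where l: "l = Suc n" using assms by (cases l) auto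
  let ?L = "\<lambda>n. {ks. set ks \<subseteq> V \<and> length ks = n}"
  let ?F = "\<lambda>l i ks. (\<Prod>r<l - 1. 1 / deg (ks ! r)) * (\<Prod>r<l. w ((i # ks @ [j]) ! r) ((i # ks @ [j]) ! Suc r))"
  have L: "?L (Suc n) = (\<lambda>(k, ks). k # ks) ` (V \<times> ?L n)"
    by (auto simp: length_Suc_conv image_iff)
  have "inj_on (\<lambda>(k, ks). k # ks) (V \<times> ?L n)" by (auto simp: inj_on_def)
  then have "neighborhood_weight V w (Suc l) i j = (\<Sum>(k, ks)\<in>V \<times> ?L n. ?F (Suc l) i (k # ks))"
    by (simp add: neighborhood_weight_def l L sum.reindex case_prod_unfold)
  also have "\<dots> = (\<Sum>k\<in>V. \<Sum>ks\<in>?L n. ?F (Suc l) i (k # ks))"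
    by (simp add: sum.cartesian_product)
  also have "\<dots> = (\<Sum>k\<in>V. \<Sum>ks\<in>?L n. w i k / deg k * ?F l k ks)"
    by (intro sum.cong refl) (simp add: l prod.lessThan_Suc_shift del: prod.lessThan_Suc)
  finally show ?thesis
    by (simp add: neighborhood_weight_def l sum_distrib_left)
qed

lemma neighborhood_weight_nonneg:
  assumes "l \<ge> 1" "i \<in> V" "j \<in> V"
  shows "neighborhood_weight V w l i j \<ge> 0"
  using assms
proof (induction l arbitrary: i rule: nat_induct_at_least)
  case base
  then show ?case by (simp add: neighborhood_weight_1[unfolded One_nat_def] w_nonneg)
next
  case (Suc l)
  then show ?case
    by (simp add: neighborhood_weight_Suc)
       (intro sum_nonneg mult_nonneg_nonneg divide_nonneg_pos w_nonneg degree_pos; simp)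
qed

text \<open>The matrix identity \<open>W[l] = D P^l\<close>, tested on \<open>v\<close>. Degrees,
  symmetry and transition operator of \<open>\<Gamma>[l]\<close> are all read off from it.\<close>

lemma neighborhood_weight_sum:
  assumes "l \<ge> 1" "i \<in> V"
  shows "(\<Sum>j\<in>V. neighborhood_weight V w l i j * v j) = deg i * (P ^^ l) v i"
  using assms
proof (induction l arbitrary: i rule: nat_induct_at_least)
  case base
  then show ?case by (simp add: neighborhood_weight_1[unfolded One_nat_def] deg_mult_transition_op)
next
  case (Suc l)
  have "(\<Sum>j\<in>V. neighborhood_weight V w (Suc l) i j * v j)
      = (\<Sum>j\<in>V. \<Sum>k\<in>V. w i k / deg k * (neighborhood_weight V w l k j * v j))"
    using Suc.hyps by (simp add: neighborhood_weight_Suc sum_distrib_right mult.assoc)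
  also have "\<dots> = (\<Sum>k\<in>V. w i k / deg k * (\<Sum>j\<in>V. neighborhood_weight V w l k j * v j))"
    by (subst sum.swap) (simp add: sum_distrib_left)
  also have "\<dots> = (\<Sum>k\<in>V. w i k * (P ^^ l) v k)"
    using degree_pos by (intro sum.cong refl) (simp add: Suc.IH less_imp_neq[symmetric])
  finally show ?case using Suc.prems by (simp add: deg_mult_transition_op)
qed

lemma degree_neighborhood_weight:
  assumes "l \<ge> 1" "i \<in> V"
  shows "degree V (neighborhood_weight V w l) i = deg i"
  using neighborhood_weight_sum[OF assms, of "\<lambda>_. 1"] assms
  by (simp add: degree_def[of V "neighborhood_weight V w l"] transition_op_power_const)

text \<open>The weights are the matrix entries of \<open>P ^^ l\<close> between indicator functions,
  so self-adjointness of \<open>P ^^ l\<close> gives symmetry.\<close>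

lemma neighborhood_weight_sym:
  assumes "l \<ge> 1" "i \<in> V" "j \<in> V"
  shows "neighborhood_weight V w l i j = neighborhood_weight V w l j i"
proof -
  let ?\<delta> = "\<lambda>j i. if i = j then 1 else 0 :: real"
  have *: "neighborhood_weight V w l i j = inner_prod (?\<delta> i) ((P ^^ l) (?\<delta> j))"
    if "i \<in> V" "j \<in> V" for i j
  proof -
    have "neighborhood_weight V w l i j = (\<Sum>k\<in>V. neighborhood_weight V w l i k * ?\<delta> j k)"
      using that finite_V by (simp add: if_distrib cong: if_cong)
    also have "\<dots> = deg i * (P ^^ l) (?\<delta> j) i"
      using assms(1) that(1) by (rule neighborhood_weight_sum)
    also have "\<dots> = inner_prod (?\<delta> i) ((P ^^ l) (?\<delta> j))"
      using that finite_V by (simp add: inner_prod_def if_distrib[of "\<lambda>x. x * _"] if_distrib[of "\<lambda>x. _ * x"] cong: if_cong)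
    finally show ?thesis .
  qed
  show ?thesis
    using assms by (simp only: * transition_op_power_self_adjoint[of "?\<delta> i"] inner_prod_commute[of _ "?\<delta> j"])
qed

lemma weighted_network_neighborhood:
  assumes "l \<ge> 1"
  shows "weighted_network V (neighborhood_weight V w l)"
  by unfold_locales
     (use assms finite_V degree_pos in \<open>auto intro: neighborhood_weight_sym neighborhood_weight_nonneg simp: degree_neighborhood_weight\<close>)

lemma transition_op_neighborhood_weight:
  assumes "l \<ge> 1" "i \<in> V"
  shows "transition_op V (neighborhood_weight V w l) v i = (P ^^ l) v i"
  unfolding transition_op_def[of V "neighborhood_weight V w l"] neighborhood_weight_sum[OF assms]
    degree_neighborhood_weight[OF assms]
  using degree_pos[OF assms(2)] by simp

text \<open>Since \<open>\<Gamma>[l]\<close> has the same degrees, it has the same inner product and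
  the same mean-zero functions; only the transition operator changes, to
  \<open>P ^^ l\<close>.\<close>

lemma neighborhood_cheeger_inequality:
  assumes "card V \<ge> 2" "l \<ge> 1" "(\<Sum>i\<in>V. deg i * v i) = 0"
  shows "inner_prod v ((P ^^ l) v) \<le> sqrt (1 - (neighborhood_cheeger V w l)\<^sup>2) * sq_norm v"
proof -
  interpret nb: weighted_network V "neighborhood_weight V w l"
    using assms(2) by (rule weighted_network_neighborhood)
  have ip: "nb.inner_prod u u' = inner_prod u u'" for u u'
    using assms(2) by (simp add: nb.inner_prod_def inner_prod_def degree_neighborhood_weight)
  have "inner_prod v ((P ^^ l) v) = nb.inner_prod v (nb.P v)"
    unfolding ip using assms(2) by (intro inner_prod_cong) (simp_all add: transition_op_neighborhood_weight)
  also have "\<dots> \<le> sqrt (1 - (neighborhood_cheeger V w l)\<^sup>2) * nb.sq_norm v"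
    unfolding neighborhood_cheeger_def using assms
    by (intro nb.cheeger_inequality) (simp_all add: degree_neighborhood_weight)
  finally show ?thesis by (simp add: ip)
qed

section \<open>Norm decay by log-convexity\<close>

text \<open>The sum is the inner product with 1, which \<open>P\<close> fixes. Mean zero therefore
  survives each step of the walk, which allows iteration.\<close>

lemma sum_deg_transition_op_power: "(\<Sum>i\<in>V. deg i * (P ^^ n) v i) = (\<Sum>i\<in>V. deg i * v i)"
proof -
  have "(\<Sum>i\<in>V. deg i * (P ^^ n) v i) = inner_prod (\<lambda>_. 1) ((P ^^ n) v)"
    by (simp add: inner_prod_def)
  also have "\<dots> = (\<Sum>i\<in>V. deg i * v i)"
    unfolding transition_op_power_self_adjoint by (simp add: inner_prod_def transition_op_power_const)
  finally show ?thesis .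
qed

text \<open>Moving one \<open>P\<close> across the inner product of \<open>(P ^^ n) v\<close> and
  \<open>(P ^^ Suc (Suc n)) v\<close> produces the middle squared norm; Cauchy-Schwarz does the
  rest.\<close>

lemma sq_norm_transition_op_power_log_convex:
  "(sq_norm ((P ^^ Suc n) v))\<^sup>2 \<le> sq_norm ((P ^^ n) v) * sq_norm ((P ^^ Suc (Suc n)) v)"
  using inner_prod_Cauchy_Schwarz[of "(P ^^ n) v" "(P ^^ Suc (Suc n)) v"]
  by (simp add: transition_op_self_adjoint)

end

text \<open>Successive ratios of a log-convex sequence increase, so the first is the smallest. The
  cross-multiplied form admits zero terms.\<close>

lemma log_convex_ratio_mono:
  fixes a :: "nat \<Rightarrow> real"
  assumes nonneg: "\<And>n. a n \<ge> 0" and convex: "\<And>n. (a (Suc n))\<^sup>2 \<le> a n * a (Suc (Suc n))"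
  shows "a 1 * a n \<le> a 0 * a (Suc n)"
proof (induction n)
  case (Suc n)
  show ?case
  proof (cases "a (Suc n) = 0")
    case False
    then have "(a (Suc n))\<^sup>2 > 0" by simp
    \<comment> \<open>Convexity at \<open>n\<close> excludes a zero here, so \<open>a n\<close> can
      be cancelled at the end.\<close>
    then have "a n \<noteq> 0" using convex[of n] by auto
    then have pos: "a n > 0" using nonneg[of n] by simp
    have "a n * (a 1 * a (Suc n)) \<le> a 0 * (a (Suc n))\<^sup>2"
      using mult_right_mono[OF Suc nonneg[of "Suc n"]] by (simp add: power2_eq_square algebra_simps)
    also have "\<dots> \<le> a n * (a 0 * a (Suc (Suc n)))"
      using mult_left_mono[OF convex[of n] nonneg[of 0]] by (simp add: algebra_simps)
    finally show ?thesis using pos by simp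
  qed (simp add: nonneg)
qed simp

text \<open>Multiplying the ratio bounds gives
  \<open>(a 1 / a 0)^(n + 1) \<le> a (n + 1) / a 0\<close>, stated here without division.\<close>

lemma log_convex_power_le:
  fixes a :: "nat \<Rightarrow> real"
  assumes nonneg: "\<And>n. a n \<ge> 0" and convex: "\<And>n. (a (Suc n))\<^sup>2 \<le> a n * a (Suc (Suc n))"
  shows "a 1 ^ Suc n \<le> a (Suc n) * a 0 ^ n"
proof (induction n)
  case (Suc n)
  have "a 1 ^ Suc (Suc n) \<le> a 1 * (a (Suc n) * a 0 ^ n)"
    using mult_left_mono[OF Suc nonneg[of 1]] by simp
  also have "\<dots> \<le> a 0 * a (Suc (Suc n)) * a 0 ^ n"
    using mult_right_mono[OF log_convex_ratio_mono[of a "Suc n", OF assms] zero_le_power[OF nonneg[of 0], of n]]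
    by (simp add: mult.assoc)
  finally show ?case by (simp add: algebra_simps)
qed simp

context weighted_network
begin

lemma sq_norm_transition_op_le:
  assumes card: "card V \<ge> 2" and l: "l \<ge> 2" "even l" and mean: "(\<Sum>i\<in>V. deg i * v i) = 0"
  shows "sq_norm (P v) \<le> (1 - (neighborhood_cheeger V w l)\<^sup>2) powr (1 / real l) * sq_norm v"
proof -
  define \<beta> where "\<beta> = 1 - (neighborhood_cheeger V w l)\<^sup>2"
  interpret nb: weighted_network V "neighborhood_weight V w l"
    using l by (intro weighted_network_neighborhood) simp
  have \<beta>: "\<beta> \<ge> 0" using nb.cheeger_constant_range[OF card]
    by (simp add: \<beta>_def neighborhood_cheeger_def abs_square_le_1)
  \<comment> \<open>Half of \<open>l\<close> becomes \<open>Suc n\<close>, the exponent in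
    \<open>log_convex_power_le\<close>.\<close>
  define n where "n = l div 2 - 1"
  have n: "l = Suc n + Suc n" using l by (auto simp: n_def elim!: evenE)
  define a where "a k = sq_norm ((P ^^ k) v)" for k
  \<comment> \<open>Evenness enters here: half of the \<open>l\<close> factors \<open>P\<close> move
    to the other argument.\<close>
  have "a (Suc n) = inner_prod v ((P ^^ l) v)"
    unfolding a_def n funpow_add comp_def by (simp only: transition_op_power_self_adjoint[of v])
  also have "\<dots> \<le> sqrt \<beta> * sq_norm v"
    unfolding \<beta>_def using card l mean by (intro neighborhood_cheeger_inequality) simp_all
  finally have a: "a (Suc n) \<le> sqrt \<beta> * a 0" by (simp add: a_def)
  have "a 1 ^ Suc n \<le> a (Suc n) * a 0 ^ n"
    unfolding a_def by (intro log_convex_power_le sq_norm_nonneg sq_norm_transition_op_power_log_convex)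
  also have "\<dots> \<le> sqrt \<beta> * a 0 * a 0 ^ n"
    using a by (intro mult_right_mono) (simp_all add: a_def sq_norm_nonneg)
  also have "sqrt \<beta> = (\<beta> powr (1 / real l)) ^ Suc n"
  proof -
    have "1 / real l * real (Suc n) = 1 / 2" by (simp add: n field_simps)
    moreover have "(\<beta> powr (1 / real l)) ^ Suc n = \<beta> powr (1 / real l * real (Suc n))"
      by (simp add: powr_powr flip: powr_realpow' del: power_Suc)
    ultimately show ?thesis using \<beta> by (simp only: powr_half_sqrt)
  qed
  finally have "a 1 ^ Suc n \<le> (\<beta> powr (1 / real l) * a 0) ^ Suc n"
    by (simp add: algebra_simps)
  then have "a 1 \<le> \<beta> powr (1 / real l) * a 0"
    by (rule power_le_imp_le_base) (simp add: a_def sq_norm_nonneg)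
  then show ?thesis by (simp add: a_def \<beta>_def)
qed

lemma sq_norm_transition_op_power_le:
  assumes "card V \<ge> 2" "l \<ge> 2" "even l" "(\<Sum>i\<in>V. deg i * v i) = 0"
  shows "sq_norm ((P ^^ t) v) \<le> ((1 - (neighborhood_cheeger V w l)\<^sup>2) powr (1 / real l)) ^ t * sq_norm v"
proof (induction t)
  case (Suc t)
  let ?\<rho> = "(1 - (neighborhood_cheeger V w l)\<^sup>2) powr (1 / real l)"
  have "sq_norm ((P ^^ Suc t) v) \<le> ?\<rho> * sq_norm ((P ^^ t) v)"
    using assms sq_norm_transition_op_le[of l "(P ^^ t) v"] by (simp add: sum_deg_transition_op_power)
  also have "\<dots> \<le> ?\<rho> * (?\<rho> ^ t * sq_norm v)" by (intro mult_left_mono Suc) simp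
  finally show ?case by (simp add: mult.assoc)
qed simp

section \<open>Centering and convergence to the mean\<close>

lemma sum_deg_diff_mean:
  assumes "V \<noteq> {}"
  shows "(\<Sum>i\<in>V. deg i * (f i - weighted_mean V w f)) = 0"
proof -
  have "volume V w \<noteq> 0" using sum_deg_pos[of V] assms by (simp add: volume_def)
  then show ?thesis
    unfolding right_diff_distrib sum_subtractf sum_distrib_right[symmetric] volume_def[symmetric]
    by (simp add: weighted_mean_def)
qed

text \<open>Centering is an orthogonal projection: the centered function has mean zero, and shifting
  it back by the mean can only increase the norm.\<close>

lemma sq_norm_diff_mean_le:
  assumes "V \<noteq> {}"
  shows "sq_norm (\<lambda>i. f i - weighted_mean V w f) \<le> sq_norm f"
  using sq_norm_le_diff_const[OF sum_deg_diff_mean[OF assms], of f "- weighted_mean V w f"] by simp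

end

text \<open>A path from \<open>i\<close> to a different vertex starts with an edge at
  \<open>i\<close>, whose weight makes the degree positive. This is where connectedness
  enters.\<close>

lemma (in connected_weighted_graph) weighted_network:
  assumes "card V \<ge> 2"
  shows "weighted_network V w"
proof
  have nonneg: "w i j \<ge> 0" if "i \<in> V" "j \<in> V" for i j
    using weight_edge[of i j] weight_nonedge[OF that] by (cases "(i, j) \<in> E") auto
  show "degree V w i > 0" if i: "i \<in> V" for i
  proof -
    have "V \<noteq> {i}" using assms by auto
    then obtain j where "j \<in> V" "j \<noteq> i" using i by auto
    then obtain k where k: "(i, k) \<in> E"
      using connected[OF i, of j] by (metis converse_rtranclE)
    then have "k \<in> V" using edges_subset by auto
    then show ?thesis
      unfolding degree_def using finite_vertices weight_edge[OF k] nonneg[OF i] by (intro sum_pos2)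
  qed
  show "finite V" by (rule finite_vertices)
  show "w i j = w j i" if "i \<in> V" "j \<in> V" for i j using that by (rule weight_sym)
  show "w i j \<ge> 0" if "i \<in> V" "j \<in> V" for i j using that by (rule nonneg)
qed

theorem theorem9p2:
  fixes V :: "'a set" and E :: "('a \<times> 'a) set" and w :: "'a \<Rightarrow> 'a \<Rightarrow> real"
    and f :: "'a \<Rightarrow> real" and t l :: nat
  assumes "connected_weighted_graph V E w"
    and "card V \<ge> 2"
    and "t > 0"
    and "l \<ge> 2" and "even l"
  shows "weighted_norm V w (\<lambda>i. (transition_op V w ^^ t) f i - weighted_mean V w f)
       \<le> (1 - (neighborhood_cheeger V w l)\<^sup>2) powr (real t / (2 * real l)) * weighted_norm V w f"
proof -
  interpret weighted_network V w
    using connected_weighted_graph.weighted_network[OF assms(1,2)] .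
  define \<beta> where "\<beta> = 1 - (neighborhood_cheeger V w l)\<^sup>2"
  define g where "g i = f i - weighted_mean V w f" for i
  have ne: "V \<noteq> {}" using assms(2) by auto
  \<comment> \<open>Constants are fixed by \<open>P\<close>, so the mean may be subtracted before
    walking.\<close>
  have "sq_norm (\<lambda>i. (P ^^ t) f i - weighted_mean V w f) = sq_norm ((P ^^ t) g)"
    by (intro inner_prod_cong) (simp_all add: g_def[abs_def] transition_op_power_diff_const)
  also have "\<dots> \<le> (\<beta> powr (1 / real l)) ^ t * sq_norm g"
    unfolding \<beta>_def using assms(2,4,5) sum_deg_diff_mean[OF ne]
    by (intro sq_norm_transition_op_power_le) (simp_all add: g_def)
  also have "\<dots> \<le> (\<beta> powr (1 / real l)) ^ t * sq_norm f"
    using sq_norm_diff_mean_le[OF ne, of f] by (intro mult_left_mono) (simp_all add: g_def[abs_def])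
  \<comment> \<open>The square prepares for taking roots, which halves the exponent. Positivity of
    \<open>t\<close> covers a zero base, where \<open>powr\<close> with exponent 0 gives 0 but
    \<open>^\<close> gives 1.\<close>
  also have "(\<beta> powr (1 / real l)) ^ t = (\<beta> powr (real t / (2 * real l)))\<^sup>2"
    using assms(3) by (simp add: powr_power powr_powr flip: powr_realpow')
  finally show ?thesis
    unfolding weighted_norm_eq \<beta>_def[symmetric]
    by (metis real_sqrt_le_iff real_sqrt_mult real_sqrt_abs abs_of_nonneg powr_ge_zero)
qed

end
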